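(* Let $q>2$ be a prime power. If there exists an $[n,k]_{q^2}$ GRS code with $l$-dimensional Hermitian hull, where $0\le l\le k$, then for any $1\le i\le\min\{l,q^2+1-n\}$ and each $0\le s\le l-i$ there exists an $[n+i,k]_{q^2}$ MDS code with $s$-dimensional Hermitian hull.
   Context: For a linear code $\mathcal C\subseteq\mathbb F_{q^2}^n$, $\mathcal C^{\perp_H}=\{\bm x:\sum_i y_ix_i^q=0\ \text{for all }\bm y\in\mathcal C\}$, and the Hermitian hull is $\mathrm{Hull}_H(\mathcal C)=\mathcal C\cap\mathcal C^{\perp_H}$. An $[n,k]_{q^2}$ GRS code ($1\le k\le n$) is a code $\{(v_1f(a_1),\dots,v_nf(a_n)):f\in\mathbb F_{q^2}[x],\deg f\le k-1\}$ with distinct $a_j\in\mathbb F_{q^2}$ and $v_j\in\mathbb F_{q^2}^*$. An $[n,k]$ code is MDS if its minimum distance is $n-k+1$. *)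

theory Defs
  imports
    "HOL-Library.Cardinality"
    "HOL-Number_Theory.Prime_Powers"
    "Jordan_Normal_Form.VS_Connect"
begin

definition linear_code :: "nat \<Rightarrow> 'a::field vec set \<Rightarrow> bool" where
  "linear_code n C \<longleftrightarrow> VectorSpace.subspace class_ring C (module_vec TYPE('a) n)"

definition code_dim :: "nat \<Rightarrow> 'a::field vec set \<Rightarrow> nat" where
  "code_dim n C = vectorspace.dim class_ring ((module_vec TYPE('a) n)\<lparr>carrier := C\<rparr>)"

text \<open>The Hermitian notions are meant for a field with \<open>q\<^sup>2\<close> elements, where
  \<open>x \<mapsto> x ^ q\<close> is the conjugation over the subfield with \<open>q\<close> elements.\<close>

definition hermitian_dual :: "nat \<Rightarrow> nat \<Rightarrow> 'a::field vec set \<Rightarrow> 'a vec set" where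
  "hermitian_dual q n C =
     {x \<in> carrier_vec n. \<forall>y\<in>C. (\<Sum>i<n. y $ i * (x $ i) ^ q) = 0}"

definition hermitian_hull :: "nat \<Rightarrow> nat \<Rightarrow> 'a::field vec set \<Rightarrow> 'a vec set" where
  "hermitian_hull q n C = C \<inter> hermitian_dual q n C"

definition GRS_code :: "nat \<Rightarrow> nat \<Rightarrow> 'a::field vec set \<Rightarrow> bool" where
  "GRS_code n k C \<longleftrightarrow> 1 \<le> k \<and> k \<le> n \<and>
     (\<exists>a v :: nat \<Rightarrow> 'a. inj_on a {..<n} \<and> (\<forall>j<n. v j \<noteq> 0) \<and>
        C = {vec n (\<lambda>j. v j * poly f (a j)) | f. degree f \<le> k - 1})"

definition hamming_dist :: "nat \<Rightarrow> 'a vec \<Rightarrow> 'a vec \<Rightarrow> nat" where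
  "hamming_dist n x y = card {j. j < n \<and> x $ j \<noteq> y $ j}"

text \<open>Only meaningful for codes with at least two codewords.\<close>

definition min_dist :: "nat \<Rightarrow> 'a vec set \<Rightarrow> nat" where
  "min_dist n C = Min {hamming_dist n x y | x y. x \<in> C \<and> y \<in> C \<and> x \<noteq> y}"

definition MDS_code :: "nat \<Rightarrow> nat \<Rightarrow> 'a::field vec set \<Rightarrow> bool" where
  "MDS_code n k C \<longleftrightarrow> linear_code n C \<and> code_dim n C = k \<and> min_dist n C = n - k + 1"

end

theory Submission
  imports "HOL-Number_Theory.Residues" Defs
begin

text \<open>Adding \<open>i\<close> points of the projective line to the evaluation set of the GRS code keeps it
  MDS, and those hull vectors that vanish at the new points stay in the hull, so the hull dimension
  is still at least \<open>l - i\<close>. For \<open>q > 2\<close> there is a scalar of norm different from \<open>0\<close> and \<open>1\<close>;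
  multiplying a coordinate in the support of the hull by it lowers the hull dimension by exactly one,
  so every smaller dimension is reached. Since the field is finite, dimensions are compared by
  counting codewords.\<close>

section \<open>Linear codes and their cardinality\<close>

lemma linear_code_iff:
  fixes C :: "'a::field vec set"
  shows "linear_code n C \<longleftrightarrow> C \<subseteq> carrier_vec n \<and> 0\<^sub>v n \<in> C \<and>
    (\<forall>x\<in>C. \<forall>y\<in>C. x + y \<in> C) \<and> (\<forall>c. \<forall>x\<in>C. c \<cdot>\<^sub>v x \<in> C)"
  unfolding linear_code_def VectorSpace.subspace_def submodule_def
  by (auto simp: vec_vs vec_module module_vec_simps)

lemma linear_codeD:
  fixes C :: "'a::field vec set"
  assumes "linear_code n C"
  shows "x \<in> C \<Longrightarrow> x \<in> carrier_vec n" and "0\<^sub>v n \<in> C"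
    and "x \<in> C \<Longrightarrow> y \<in> C \<Longrightarrow> x + y \<in> C" and "x \<in> C \<Longrightarrow> c \<cdot>\<^sub>v x \<in> C"
  using assms unfolding linear_code_iff by blast+

lemma linear_code_diff:
  fixes C :: "'a::field vec set"
  assumes "linear_code n C" "x \<in> C" "y \<in> C"
  shows "x - y \<in> C"
proof -
  have "x - y = x + (-1) \<cdot>\<^sub>v y"
    using linear_codeD(1)[OF assms(1)] assms(2,3) by (intro eq_vecI) fastforce+
  then show ?thesis
    using assms linear_codeD(3,4) by metis
qed

lemma finite_carrier_vec: "finite (carrier_vec n :: 'a::finite vec set)"
proof (rule finite_subset)
  show "carrier_vec n \<subseteq> vec_of_list ` {xs :: 'a list. set xs \<subseteq> UNIV \<and> length xs = n}"
  proof
    fix x :: "'a vec" assume "x \<in> carrier_vec n"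
    then show "x \<in> vec_of_list ` {xs. set xs \<subseteq> UNIV \<and> length xs = n}"
      by (intro image_eqI[of _ _ "list_of_vec x"]) (auto simp: vec_list)
  qed
qed (rule finite_imageI[OF finite_lists_length_eq[OF finite]])

lemma card_carrier_vec_le: "card (carrier_vec n :: 'a::finite vec set) \<le> CARD('a) ^ n"
proof -
  have "card (carrier_vec n :: 'a vec set) \<le> card {xs :: 'a list. set xs \<subseteq> UNIV \<and> length xs = n}"
  proof (rule card_inj_on_le)
    show "inj_on list_of_vec (carrier_vec n :: 'a vec set)"
      by (metis inj_onI vec_list)
    show "finite {xs :: 'a list. set xs \<subseteq> UNIV \<and> length xs = n}"
      by (rule finite_lists_length_eq[OF finite])
  qed auto
  then show ?thesis
    by (simp add: card_lists_length_eq[OF finite, of UNIV, simplified])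
qed

lemma linear_code_finite:
  fixes C :: "'a::{field,finite} vec set"
  assumes "linear_code n C"
  shows "finite C"
  using assms finite_carrier_vec finite_subset unfolding linear_code_iff by blast

text \<open>Coordinates with respect to a basis identify the code with the functions from the basis
  to the field. Through this count, later claims about dimension become claims about
  cardinality.\<close>

lemma card_linear_code:
  fixes C :: "'a::{field,finite} vec set"
  assumes C: "linear_code n C"
  shows "card C = CARD('a) ^ code_dim n C"
proof -
  let ?R = "class_ring :: 'a ring"
  let ?V = "(module_vec TYPE('a) n)\<lparr>carrier := C\<rparr>"
  interpret W: vectorspace ?R "module_vec TYPE('a) n" by (rule vec_vs)
  interpret vectorspace ?R ?V
    using C unfolding linear_code_def by (rule W.subspace_is_vs)
  have [simp]: "carrier ?V = C" by simp
  \<comment> \<open>The finite set \<open>C\<close> spans itself, which yields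
    \<open>fin_dim\<close> and hence a finite basis.\<close>
  have "span C = C"
  proof
    show "span C \<subseteq> C" using span_is_subset2[of C] by simp
    show "C \<subseteq> span C" using in_own_span[of C] by simp
  qed
  then have "fin_dim"
    unfolding fin_dim_def using linear_code_finite[OF C] by auto
  then obtain B where B: "finite B" "basis B"
    using finite_basis_exists by blast
  have BC: "B \<subseteq> C" using B(2) unfolding basis_def by simp
  \<comment> \<open>Restricting to extensional functions on \<open>B\<close> makes the coefficients
    of a codeword unique, so \<open>lincomb\<close> is a bijection.\<close>
  have ex1: "\<forall>v. v \<in> C \<longrightarrow> (\<exists>!a. a \<in> B \<rightarrow>\<^sub>E (UNIV :: 'a set) \<and> lincomb a B = v)"
    using basis_criterion[of B] B BC by simp
  have "bij_betw (\<lambda>a. lincomb a B) (B \<rightarrow>\<^sub>E (UNIV :: 'a set)) C"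
    unfolding bij_betw_def
  proof
    have in_C: "lincomb a B \<in> C" for a :: "'a vec \<Rightarrow> 'a"
      using lincomb_closed[of B a] BC by simp
    show "inj_on (\<lambda>a. lincomb a B) (B \<rightarrow>\<^sub>E (UNIV :: 'a set))"
      using ex1 in_C unfolding inj_on_def by metis
    show "(\<lambda>a. lincomb a B) ` (B \<rightarrow>\<^sub>E (UNIV :: 'a set)) = C"
    proof
      show "C \<subseteq> (\<lambda>a. lincomb a B) ` (B \<rightarrow>\<^sub>E (UNIV :: 'a set))"
        using ex1 by blast
    qed (use in_C in blast)
  qed
  then have "card C = card (B \<rightarrow>\<^sub>E (UNIV :: 'a set))"
    by (simp add: bij_betw_same_card)
  also have "\<dots> = CARD('a) ^ card B"
    by (simp add: card_funcsetE B)
  also have "card B = code_dim n C"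
    unfolding code_dim_def using dim_basis[OF B] by simp
  finally show ?thesis .
qed

lemma two_le_CARD: "2 \<le> CARD('a::{field,finite})"
proof -
  have "card {0, 1 :: 'a} \<le> CARD('a)" by (intro card_mono) auto
  then show ?thesis by simp
qed

text \<open>The base is at least 2, so exponents can be read off; this turns counts of codewords
  back into dimensions.\<close>

lemma CARD_power_inject:
  "CARD('a::{field,finite}) ^ m = CARD('a) ^ m' \<longleftrightarrow> m = m'"
  "CARD('a) ^ m \<le> CARD('a) ^ m' \<longleftrightarrow> m \<le> m'"
  using two_le_CARD[where 'a='a] by auto

section \<open>Rescaling coordinates\<close>

text \<open>The action of the diagonal matrix with entries \<open>u j\<close>. Nonzero entries
  preserve Hamming distances but may change Hermitian products.\<close>

definition scale_vec :: "nat \<Rightarrow> (nat \<Rightarrow> 'a) \<Rightarrow> 'a vec \<Rightarrow> 'a::field vec" where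
  "scale_vec n u x = vec n (\<lambda>j. u j * x $ j)"

lemma scale_vec_carrier [simp]: "scale_vec n u x \<in> carrier_vec n" "dim_vec (scale_vec n u x) = n"
  by (simp_all add: scale_vec_def)

lemma scale_vec_index [simp]: "j < n \<Longrightarrow> scale_vec n u x $ j = u j * x $ j"
  by (simp add: scale_vec_def)

lemma scale_vec_inj:
  assumes "\<forall>j<n. u j \<noteq> 0"
  shows "inj_on (scale_vec n u) (carrier_vec n)"
proof (rule inj_onI)
  fix x y :: "'a vec"
  assume xy: "x \<in> carrier_vec n" "y \<in> carrier_vec n" "scale_vec n u x = scale_vec n u y"
  show "x = y"
  proof (rule eq_vecI)
    fix j assume "j < dim_vec y"
    then have "j < n" using xy by auto
    then have "u j * x $ j = u j * y $ j" using xy(3) by (metis scale_vec_index)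
    then show "x $ j = y $ j" using assms \<open>j < n\<close> by simp
  qed (use xy in auto)
qed

lemma linear_code_scale:
  fixes C :: "'a::field vec set"
  assumes C: "linear_code n C"
  shows "linear_code n (scale_vec n u ` C)"
  unfolding linear_code_iff
proof (intro conjI ballI allI)
  have "0\<^sub>v n = scale_vec n u (0\<^sub>v n)" by (intro eq_vecI) auto
  then show "0\<^sub>v n \<in> scale_vec n u ` C" using linear_codeD(2)[OF C] by blast
next
  fix x y assume "x \<in> scale_vec n u ` C" "y \<in> scale_vec n u ` C"
  then obtain x' y' where xy: "x' \<in> C" "y' \<in> C" "x = scale_vec n u x'" "y = scale_vec n u y'"
    by blast
  then have "x + y = scale_vec n u (x' + y')"
    using linear_codeD(1)[OF C] by (intro eq_vecI) (fastforce simp: algebra_simps)+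
  then show "x + y \<in> scale_vec n u ` C" using xy linear_codeD(3)[OF C] by blast
next
  fix c x assume "x \<in> scale_vec n u ` C"
  then obtain x' where x: "x' \<in> C" "x = scale_vec n u x'"
    by blast
  then have "c \<cdot>\<^sub>v x = scale_vec n u (c \<cdot>\<^sub>v x')"
    using linear_codeD(1)[OF C] by (intro eq_vecI) (fastforce simp: algebra_simps)+
  then show "c \<cdot>\<^sub>v x \<in> scale_vec n u ` C" using x linear_codeD(4)[OF C] by blast
qed auto

lemma scale_scale: "scale_vec n u ` scale_vec n v ` C = scale_vec n (\<lambda>j. u j * v j) ` C"
  unfolding image_image by (intro image_cong refl eq_vecI) auto

text \<open>Nonzero factors keep the positions where two words differ, and injectivity keeps the
  number of codewords, hence the dimension.\<close>

lemma MDS_code_scale: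
  fixes C :: "'a::{field,finite} vec set"
  assumes C: "MDS_code n k C" and u: "\<forall>j<n. u j \<noteq> 0"
  shows "MDS_code n k (scale_vec n u ` C)"
proof -
  let ?f = "scale_vec n u"
  have lin: "linear_code n C" and dim: "code_dim n C = k" and dist: "min_dist n C = n - k + 1"
    using C unfolding MDS_code_def by auto
  have inj: "inj_on ?f C"
    using scale_vec_inj[OF u] linear_codeD(1)[OF lin] by (meson inj_on_subset subsetI)
  have lin': "linear_code n (?f ` C)" by (rule linear_code_scale[OF lin])
  have "CARD('a) ^ code_dim n (?f ` C) = CARD('a) ^ code_dim n C"
    using card_linear_code[OF lin'] card_linear_code[OF lin] card_image[OF inj] by simp
  then have dim': "code_dim n (?f ` C) = k"
    unfolding CARD_power_inject using dim by simp
  have hd: "hamming_dist n (?f x) (?f y) = hamming_dist n x y" for x y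
    unfolding hamming_dist_def using u by (intro arg_cong[of _ _ card]) auto
  have "{hamming_dist n x y | x y. x \<in> ?f ` C \<and> y \<in> ?f ` C \<and> x \<noteq> y} =
      {hamming_dist n x y | x y. x \<in> C \<and> y \<in> C \<and> x \<noteq> y}" (is "?L = ?R")
  proof
    show "?L \<subseteq> ?R" using hd by blast
    show "?R \<subseteq> ?L" using hd inj unfolding inj_on_def by (smt (verit) image_eqI mem_Collect_eq subsetI)
  qed
  then have "min_dist n (?f ` C) = n - k + 1"
    using dist unfolding min_dist_def by simp
  with lin' dim' show ?thesis unfolding MDS_code_def by simp
qed

section \<open>The Hermitian hull\<close>

text \<open>Multiplication by a nonzero \<open>x\<close> permutes the nonzero elements; comparing
  their products gives \<open>x ^ (CARD('a) - 1) = 1\<close>.\<close>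

lemma power_CARD_eq_same:
  fixes x :: "'a::{field,finite}"
  shows "x ^ CARD('a) = x"
proof (cases "x = 0")
  case False
  let ?P = "\<Prod>(UNIV - {0 :: 'a})"
  have "bij_betw ((*) x) (UNIV - {0}) (UNIV - {0})"
    by (rule bij_betw_byWitness[of _ "\<lambda>y. y / x"]) (use False in auto)
  then have "?P = (\<Prod>y\<in>UNIV - {0}. x * y)"
    by (rule prod.reindex_bij_betw[symmetric])
  also have "\<dots> = x ^ (CARD('a) - 1) * ?P"
    by (simp add: prod.distrib)
  finally have "x ^ (CARD('a) - 1) = 1"
    by simp
  then show ?thesis
    using power_minus_mult[of "CARD('a)" x] by simp
qed (simp add: zero_power)

text \<open>The parameter \<open>ty\<close> carries the field type, so that an interpretation can
  select it through \<open>TYPE('a)\<close>.\<close>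

locale hermitian_field =
  fixes q :: nat and ty :: "'a::{field,finite} itself"
  assumes primepow_q: "primepow q" and CARD_eq: "CARD('a) = q\<^sup>2"
begin

lemma q_pos: "q > 0"
  using primepow_gt_Suc_0[OF primepow_q] by simp

lemma zero_power_q [simp]: "(0 :: 'a) ^ q = 0"
  using q_pos by simp

text \<open>Two conjugations raise to the power q^2, which is the size of the field.\<close>

lemma frobenius_twice: "((x :: 'a) ^ q) ^ q = x"
  using power_CARD_eq_same[of x] by (simp add: CARD_eq power2_eq_square power_mult)

text \<open>The characteristic is a prime divisor of q^2, itself a power of a prime. Hence the q-th
  power is an iterated Frobenius map and additive.\<close>

lemma CHAR_power: "\<exists>m. prime CHAR('a) \<and> q = CHAR('a) ^ m"
proof -
  obtain p m where p: "prime p" "q = p ^ m"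
    using primepow_q unfolding primepow_def by blast
  have prime_CHAR: "prime CHAR('a)"
    using prime_CHAR_semidom finite_imp_CHAR_pos[where 'a='a] by simp
  have "CHAR('a) dvd CARD('a)" by (rule CHAR_dvd_CARD)
  then have "CHAR('a) dvd p"
    using prime_CHAR unfolding CARD_eq p(2) by (meson prime_dvd_power)
  then have "CHAR('a) = p"
    using p(1) prime_CHAR by (simp add: primes_dvd_imp_eq)
  then show ?thesis using p by auto
qed

lemma frobenius_sum: "(sum f A :: 'a) ^ q = (\<Sum>i\<in>A. f i ^ q)"
  using CHAR_power freshmans_dream_sum' by blast

lemma frobenius_add: "(x + y :: 'a) ^ q = x ^ q + y ^ q"
  using CHAR_power freshmans_dream' by blast

text \<open>Conjugating the Hermitian product exchanges its arguments, because conjugation is an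
  additive involution.\<close>

lemma hermitian_sum_sym:
  fixes x y :: "'a vec"
  assumes "(\<Sum>i<n. y $ i * (x $ i) ^ q) = 0"
  shows "(\<Sum>i<n. x $ i * (y $ i) ^ q) = 0"
proof -
  have "(\<Sum>i<n. x $ i * (y $ i) ^ q) = (\<Sum>i<n. y $ i * (x $ i) ^ q) ^ q"
    unfolding frobenius_sum by (simp add: power_mult_distrib frobenius_twice mult.commute)
  then show ?thesis using assms by simp
qed

lemma linear_code_hull:
  fixes C :: "'a vec set"
  assumes C: "linear_code n C"
  shows "linear_code n (hermitian_hull q n C)"
  unfolding linear_code_iff
proof (intro conjI ballI allI)
  show "hermitian_hull q n C \<subseteq> carrier_vec n"
    by (auto simp: hermitian_hull_def hermitian_dual_def)
  show "0\<^sub>v n \<in> hermitian_hull q n C"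
    using linear_codeD(2)[OF C] by (auto simp: hermitian_hull_def hermitian_dual_def)
next
  fix x y assume "x \<in> hermitian_hull q n C" "y \<in> hermitian_hull q n C"
  then show "x + y \<in> hermitian_hull q n C"
    using linear_codeD(3)[OF C]
    by (auto simp: hermitian_hull_def hermitian_dual_def frobenius_add distrib_left sum.distrib)
next
  fix c :: 'a and x assume "x \<in> hermitian_hull q n C"
  then have x: "x \<in> C" "x \<in> carrier_vec n" "\<And>y. y \<in> C \<Longrightarrow> (\<Sum>i<n. y $ i * (x $ i) ^ q) = 0"
    by (auto simp: hermitian_hull_def hermitian_dual_def)
  have "(\<Sum>i<n. y $ i * ((c \<cdot>\<^sub>v x) $ i) ^ q) = 0" if "y \<in> C" for y
  proof -
    \<comment> \<open>The form is conjugate-linear in \<open>x\<close>, so \<open>c\<close> comes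
      out as \<open>c ^ q\<close>.\<close>
    have "(\<Sum>i<n. y $ i * ((c \<cdot>\<^sub>v x) $ i) ^ q) = c ^ q * (\<Sum>i<n. y $ i * (x $ i) ^ q)"
      unfolding sum_distrib_left using x(2)
      by (intro sum.cong) (auto simp: power_mult_distrib mult_ac)
    then show ?thesis using x(3)[OF that] by simp
  qed
  then show "c \<cdot>\<^sub>v x \<in> hermitian_hull q n C"
    using x(1,2) linear_codeD(4)[OF C] by (auto simp: hermitian_hull_def hermitian_dual_def)
qed

section \<open>Changing the hull dimension by rescaling and by puncturing\<close>

lemma exists_norm_neq_1:
  assumes "q > 2"
  shows "\<exists>c :: 'a. c \<noteq> 0 \<and> c * c ^ q \<noteq> 1"
proof (rule ccontr)
  assume "\<not> ?thesis"
  \<comment> \<open>All q^2 - 1 nonzero elements would be roots of X^(q+1) - 1, so q^2 - 1 \<le> q +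
    1, which fails for q > 2.\<close>
  then have sub: "UNIV - {0} \<subseteq> {c :: 'a. poly (monom 1 (Suc q) - 1) c = 0}"
    by (auto simp: poly_monom)
  have ne: "monom 1 (Suc q) - 1 \<noteq> (0 :: 'a poly)"
  proof
    assume "monom 1 (Suc q) - 1 = (0 :: 'a poly)"
    then have "poly (monom 1 (Suc q) - 1) (0 :: 'a) = 0" by simp
    then show False by (simp add: poly_monom)
  qed
  have "CARD('a) - 1 = card (UNIV - {0 :: 'a})" by simp
  also have "\<dots> \<le> card {c :: 'a. poly (monom 1 (Suc q) - 1) c = 0}"
    using sub by (intro card_mono) auto
  also have "\<dots> \<le> degree (monom 1 (Suc q) - 1 :: 'a poly)"
    by (rule card_poly_roots_bound[OF ne])
  also have "\<dots> \<le> Suc q"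
    by (intro degree_diff_le) (auto simp: degree_monom_le)
  finally have "q * q \<le> q + 2" by (simp add: CARD_eq power2_eq_square)
  moreover have "3 * q \<le> q * q" using assms by simp
  ultimately show False using assms by linarith
qed

text \<open>If \<open>x\<close> lies in the hull and \<open>x\<^sub>j \<noteq> 0\<close>, then multiplying coordinate \<open>j\<close> by \<open>c\<close> adds
  \<open>(c\<^bsup>q+1\<^esup> - 1) z\<^sub>j y\<^sub>j\<^bsup>q\<^esup>\<close> to the form. Pairing with \<open>x\<close> forces \<open>y\<^sub>j = 0\<close>, so
  the new hull is the hyperplane \<open>y\<^sub>j = 0\<close> of the old one.\<close>

lemma hull_dim_drop:
  fixes C :: "'a vec set"
  assumes C: "linear_code n C" and q: "q > 2"
    and h: "code_dim n (hermitian_hull q n C) = Suc h"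
  shows "\<exists>u. (\<forall>j<n. u j \<noteq> 0) \<and> code_dim n (hermitian_hull q n (scale_vec n u ` C)) = h"
proof -
  define H where "H = hermitian_hull q n C"
  have H: "linear_code n H" unfolding H_def by (rule linear_code_hull[OF C])
  have H_iff: "y \<in> H \<longleftrightarrow> y \<in> C \<and> (\<forall>z\<in>C. (\<Sum>i<n. z $ i * (y $ i) ^ q) = 0)" for y
    using linear_codeD(1)[OF C] by (auto simp: H_def hermitian_hull_def hermitian_dual_def)
  have cardH: "card H = CARD('a) ^ Suc h"
    using card_linear_code[OF H] h H_def by simp
  have "H \<noteq> {0\<^sub>v n}"
  proof
    assume "H = {0\<^sub>v n}"
    then have "CARD('a) ^ Suc h = CARD('a) ^ 0" using cardH by simp
    then show False unfolding CARD_power_inject by simp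
  qed
  then obtain x where x: "x \<in> H" "x \<noteq> 0\<^sub>v n"
    using linear_codeD(2)[OF H] by blast
  then obtain j where j: "j < n" "x $ j \<noteq> 0"
    using linear_codeD(1)[OF H x(1)] by (metis carrier_vecD eq_vecI index_zero_vec)
  obtain c :: 'a where c: "c \<noteq> 0" "c * c ^ q \<noteq> 1"
    using exists_norm_neq_1[OF q] by blast
  define u where "u = (\<lambda>_. 1 :: 'a)(j := c)"
  have u: "\<forall>j<n. u j \<noteq> 0" using c by (simp add: u_def)
  define f where "f = scale_vec n u"
  have form: "(\<Sum>i<n. f z $ i * (f y $ i) ^ q) =
      (\<Sum>i<n. z $ i * (y $ i) ^ q) + (c * c ^ q - 1) * (z $ j * (y $ j) ^ q)" for z y
  proof -
    have "(\<Sum>i<n. f z $ i * (f y $ i) ^ q) = (\<Sum>i<n. z $ i * (y $ i) ^ q +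
        (if i = j then (c * c ^ q - 1) * (z $ i * (y $ i) ^ q) else 0))"
      by (intro sum.cong) (auto simp: f_def u_def power_mult_distrib algebra_simps)
    then show ?thesis using j(1) by (simp add: sum.distrib)
  qed
  define K where "K = {y \<in> H. y $ j = 0}"
  have hull: "hermitian_hull q n (f ` C) = f ` K"
  proof (intro equalityI subsetI)
    fix y' assume "y' \<in> hermitian_hull q n (f ` C)"
    then obtain y where y: "y \<in> C" "y' = f y"
      and orth: "\<And>z. z \<in> C \<Longrightarrow> (\<Sum>i<n. f z $ i * (f y $ i) ^ q) = 0"
      by (auto simp: hermitian_hull_def hermitian_dual_def)
    \<comment> \<open>Membership of \<open>x\<close> in the hull places \<open>x\<close> in the
      conjugated slot; conjugate symmetry moves it to the linear one.\<close>
    have "(\<Sum>i<n. x $ i * (y $ i) ^ q) = 0"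
      by (rule hermitian_sum_sym) (use H_iff x(1) y(1) in blast)
    moreover have "(\<Sum>i<n. f x $ i * (f y $ i) ^ q) = 0"
      using orth H_iff x(1) by blast
    ultimately have "(c * c ^ q - 1) * (x $ j * (y $ j) ^ q) = 0"
      unfolding form by simp
    then have yj: "y $ j = 0" using c j by simp
    have "(\<Sum>i<n. z $ i * (y $ i) ^ q) = 0" if "z \<in> C" for z
      using orth[OF that] yj unfolding form by simp
    then have "y \<in> K"
      using y(1) yj unfolding K_def H_iff by blast
    then show "y' \<in> f ` K" using y by simp
  next
    fix y' assume "y' \<in> f ` K"
    then obtain y where y: "y \<in> K" "y' = f y" by blast
    then have yC: "y \<in> C" and "y $ j = 0" and "\<And>z. z \<in> C \<Longrightarrow> (\<Sum>i<n. z $ i * (y $ i) ^ q) = 0"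
      by (simp_all add: K_def H_iff)
    then have "(\<Sum>i<n. f z $ i * (f y $ i) ^ q) = 0" if "z \<in> C" for z
      using that unfolding form by simp
    moreover have "f y \<in> carrier_vec n" by (simp add: f_def)
    ultimately show "y' \<in> hermitian_hull q n (f ` C)"
      using y(2) yC unfolding hermitian_hull_def hermitian_dual_def by blast
  qed
  have carr: "y \<in> carrier_vec n" if "y \<in> H" for y
    using linear_codeD(1)[OF H that] .
  \<comment> \<open>Each hull vector is uniquely a multiple of \<open>x\<close> plus a vector of
    \<open>K\<close>, with the multiple fixed by coordinate \<open>j\<close>. So \<open>K\<close> is
    smaller than \<open>H\<close> by the factor \<open>CARD('a)\<close>.\<close>
  have "bij_betw (\<lambda>(t, y). y + t \<cdot>\<^sub>v x) (UNIV \<times> K) H"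
  proof (rule bij_betw_byWitness[of _ "\<lambda>y. (y $ j / x $ j, y - (y $ j / x $ j) \<cdot>\<^sub>v x)"])
    have "(y + t \<cdot>\<^sub>v x) $ j / x $ j = t \<and> y + t \<cdot>\<^sub>v x - t \<cdot>\<^sub>v x = y" if "y \<in> K" for t y
      using that carr[OF x(1)] carr[of y] j by (auto simp: K_def intro!: eq_vecI)
    then show "\<forall>p\<in>UNIV \<times> K. (\<lambda>y. (y $ j / x $ j, y - (y $ j / x $ j) \<cdot>\<^sub>v x))
        (case p of (t, y) \<Rightarrow> y + t \<cdot>\<^sub>v x) = p"
      by force
    have "y - t \<cdot>\<^sub>v x + t \<cdot>\<^sub>v x = y" if "y \<in> H" for t y
      using carr[OF x(1)] carr[OF that] by (intro eq_vecI) auto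
    then show "\<forall>y\<in>H. (case (y $ j / x $ j, y - (y $ j / x $ j) \<cdot>\<^sub>v x) of (t, y) \<Rightarrow> y + t \<cdot>\<^sub>v x) = y"
      by simp
    show "(\<lambda>(t, y). y + t \<cdot>\<^sub>v x) ` (UNIV \<times> K) \<subseteq> H"
      using linear_codeD(3,4)[OF H] x(1) by (auto simp: K_def)
    have "y - (y $ j / x $ j) \<cdot>\<^sub>v x \<in> K" if "y \<in> H" for y
      using linear_code_diff[OF H that linear_codeD(4)[OF H x(1)]] carr[OF x(1)] j
      by (simp add: K_def)
    then show "(\<lambda>y. (y $ j / x $ j, y - (y $ j / x $ j) \<cdot>\<^sub>v x)) ` H \<subseteq> UNIV \<times> K"
      by blast
  qed
  then have cardK: "card H = CARD('a) * card K"
    by (metis bij_betw_same_card card_cartesian_product)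
  have "inj_on f K"
    using scale_vec_inj[OF u] carr unfolding f_def K_def by (auto intro: inj_on_subset)
  then have "card K = card (hermitian_hull q n (f ` C))"
    unfolding hull by (simp add: card_image)
  also have "\<dots> = CARD('a) ^ code_dim n (hermitian_hull q n (f ` C))"
    unfolding f_def by (intro card_linear_code linear_code_hull linear_code_scale C)
  finally have "CARD('a) ^ Suc h = CARD('a) ^ Suc (code_dim n (hermitian_hull q n (f ` C)))"
    using cardH cardK by simp
  then have "code_dim n (hermitian_hull q n (f ` C)) = h"
    unfolding CARD_power_inject by simp
  then show ?thesis using u f_def by blast
qed

text \<open>Descending induction from the hull dimension: the all-one scaling starts it, each step
  drops one dimension, and scalings compose.\<close>

lemma hull_dim_reduce:
  fixes C :: "'a vec set"
  assumes C: "linear_code n C" and q: "q > 2"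
    and s: "s \<le> code_dim n (hermitian_hull q n C)"
  shows "\<exists>u. (\<forall>j<n. u j \<noteq> 0) \<and> code_dim n (hermitian_hull q n (scale_vec n u ` C)) = s"
  using s
proof (induction s rule: inc_induct)
  case base
  have "scale_vec n (\<lambda>_. 1) x = x" if "x \<in> C" for x
    using linear_codeD(1)[OF C that] by (intro eq_vecI) auto
  then have "scale_vec n (\<lambda>_. 1) ` C = C" by force
  then show ?case by (intro exI[of _ "\<lambda>_. 1"]) simp
next
  case (step s)
  then obtain u where u: "\<forall>j<n. u j \<noteq> 0"
    "code_dim n (hermitian_hull q n (scale_vec n u ` C)) = Suc s" by blast
  then obtain v where v: "\<forall>j<n. v j \<noteq> 0"
    "code_dim n (hermitian_hull q n (scale_vec n v ` scale_vec n u ` C)) = s"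
    using hull_dim_drop[OF linear_code_scale[OF C] q] by blast
  then show ?case
    using u(1) unfolding scale_scale by (intro exI[of _ "\<lambda>j. v j * u j"]) simp
qed

text \<open>A codeword of \<open>D\<close> that vanishes on the last \<open>i\<close> coordinates and whose puncturing lies in
  the hull of the punctured code lies in the hull of \<open>D\<close>; these \<open>i\<close> linear conditions cost at
  most \<open>i\<close> dimensions.\<close>

lemma hull_dim_punctured_le:
  fixes D :: "'a vec set"
  assumes D: "linear_code (n + i) D" and lin: "linear_code n ((\<lambda>x. vec n (($) x)) ` D)"
  shows "code_dim n (hermitian_hull q n ((\<lambda>x. vec n (($) x)) ` D)) \<le>
    code_dim (n + i) (hermitian_hull q (n + i) D) + i"
proof -
  define pre where "pre = (\<lambda>x :: 'a vec. vec n (($) x))"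
  define suf where "suf = (\<lambda>x :: 'a vec. vec i (\<lambda>j. x $ (n + j)))"
  let ?C = "pre ` D"
  let ?H = "hermitian_hull q n ?C" and ?H' = "hermitian_hull q (n + i) D"
  have H: "linear_code n ?H"
    using lin unfolding pre_def by (rule linear_code_hull)
  have H': "linear_code (n + i) ?H'" by (rule linear_code_hull[OF D])
  \<comment> \<open>\<open>T\<close> is the preimage in \<open>D\<close> of the hull of the
    punctured code, and \<open>pre\<close> maps it onto that hull.\<close>
  define T where "T = {x \<in> D. pre x \<in> ?H}"
  have TD: "T \<subseteq> D" by (auto simp: T_def)
  have finT: "finite T" using linear_code_finite[OF D] TD finite_subset by blast
  have carr: "x \<in> carrier_vec (n + i)" if "x \<in> T" for x
    using linear_codeD(1)[OF D] that TD by blast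
  \<comment> \<open>\<open>r\<close> picks one representative in \<open>T\<close> for each suffix
    that occurs.\<close>
  define r where "r = inv_into T suf"
  have r: "r (suf x) \<in> T" "suf (r (suf x)) = suf x" if "x \<in> T" for x
    using that unfolding r_def by (auto intro: inv_into_into f_inv_into_f)
  have diff: "x - y \<in> ?H'" if x: "x \<in> T" and y: "y \<in> T" and eq: "suf x = suf y" for x y
  proof -
    have "pre x - pre y = pre (x - y)"
      using carr[OF x] carr[OF y] by (intro eq_vecI) (auto simp: pre_def)
    then have hull: "pre (x - y) \<in> ?H"
      using linear_code_diff[OF H] x y unfolding T_def by fastforce
    have zero: "(x - y) $ (n + j) = 0" if "j < i" for j
    proof -
      have "suf x $ j = suf y $ j" using eq by simp
      then show ?thesis using that carr[OF x] carr[OF y] by (simp add: suf_def)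
    qed
    have "(\<Sum>j<n + i. z $ j * ((x - y) $ j) ^ q) = 0" if "z \<in> D" for z
    proof -
      \<comment> \<open>Equal suffixes cancel, so the last \<open>i\<close> terms vanish and a
        Hermitian product in the punctured code remains.\<close>
      have "(\<Sum>j<n + i. z $ j * ((x - y) $ j) ^ q) = (\<Sum>j<n. z $ j * ((x - y) $ j) ^ q)"
      proof (rule sum.mono_neutral_right)
        show "\<forall>j\<in>{..<n + i} - {..<n}. z $ j * ((x - y) $ j) ^ q = 0"
        proof
          fix j assume "j \<in> {..<n + i} - {..<n}"
          then have "(x - y) $ (n + (j - n)) = 0" by (intro zero) auto
          then have "(x - y) $ j = 0" using \<open>j \<in> {..<n + i} - {..<n}\<close> by simp
          then show "z $ j * ((x - y) $ j) ^ q = 0" by simp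
        qed
      qed auto
      also have "\<dots> = (\<Sum>j<n. pre z $ j * (pre (x - y) $ j) ^ q)"
        by (intro sum.cong) (auto simp: pre_def)
      also have "\<dots> = 0"
        using hull that unfolding hermitian_hull_def hermitian_dual_def by blast
      finally show ?thesis .
    qed
    then show ?thesis
      using linear_code_diff[OF D, of x y] x y TD carr[OF x] carr[OF y]
      unfolding hermitian_hull_def hermitian_dual_def by auto
  qed
  \<comment> \<open>The suffix determines the representative, and the difference then recovers
    \<open>x\<close>. As there are at most \<open>CARD('a) ^ i\<close> suffixes, this bounds
    \<open>T\<close> by the hull of \<open>D\<close>.\<close>
  have "inj_on (\<lambda>x. (suf x, x - r (suf x))) T"
  proof (rule inj_onI)
    fix x y assume x: "x \<in> T" and y: "y \<in> T"
      and eq: "(suf x, x - r (suf x)) = (suf y, y - r (suf y))"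
    define w where "w = r (suf x)"
    have w: "w \<in> carrier_vec (n + i)" using carr r(1)[OF x] w_def by blast
    have cancel: "z - w + w = z" if "z \<in> T" for z
      using carr[OF that] w by (intro eq_vecI) auto
    have "x - w = y - w" using eq w_def by auto
    then have "(x - w) + w = (y - w) + w" by simp
    then show "x = y" using cancel x y by simp
  qed
  moreover have "(\<lambda>x. (suf x, x - r (suf x))) ` T \<subseteq> carrier_vec i \<times> ?H'"
    using diff r by (force simp: suf_def)
  ultimately have "card T \<le> card (carrier_vec i \<times> ?H' :: ('a vec \<times> 'a vec) set)"
    using linear_code_finite[OF H'] finite_carrier_vec by (intro card_inj_on_le) auto
  also have "\<dots> \<le> CARD('a) ^ i * card ?H'"
    by (simp add: card_cartesian_product card_carrier_vec_le)
  also have "\<dots> = CARD('a) ^ (code_dim (n + i) ?H' + i)"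
    by (simp add: card_linear_code[OF H'] power_add)
  finally have "card T \<le> CARD('a) ^ (code_dim (n + i) ?H' + i)" .
  moreover have "card ?H \<le> card T"
  proof (rule surj_card_le[OF finT])
    show "?H \<subseteq> pre ` T" unfolding T_def hermitian_hull_def by auto
  qed
  ultimately have "CARD('a) ^ code_dim n ?H \<le> CARD('a) ^ (code_dim (n + i) ?H' + i)"
    using card_linear_code[OF H] by simp
  then show ?thesis unfolding CARD_power_inject pre_def .
qed

end

section \<open>Extended generalized Reed--Solomon codes\<close>

text \<open>\<^term>\<open>None\<close> is the point at infinity of the projective line; \<open>k - 1\<close> is the degree bound.\<close>

fun eval_proj :: "nat \<Rightarrow> 'a::field poly \<Rightarrow> 'a option \<Rightarrow> 'a" where
  "eval_proj k f None = coeff f (k - 1)"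
| "eval_proj k f (Some b) = poly f b"

lemma eval_proj_add: "eval_proj k (f + g) p = eval_proj k f p + eval_proj k g p"
  and eval_proj_diff: "eval_proj k (f - g) p = eval_proj k f p - eval_proj k g p"
  and eval_proj_smult: "eval_proj k (Polynomial.smult c f) p = c * eval_proj k f p"
  by (cases p; simp)+

definition ext_GRS :: "nat \<Rightarrow> nat \<Rightarrow> (nat \<Rightarrow> 'a option) \<Rightarrow> (nat \<Rightarrow> 'a) \<Rightarrow> 'a::field vec set" where
  "ext_GRS n k a v = (\<lambda>f. vec n (\<lambda>j. v j * eval_proj k f (a j))) ` {f. degree f \<le> k - 1}"

lemma linear_code_ext_GRS: "linear_code n (ext_GRS n k a v)"
  unfolding linear_code_iff
proof (intro conjI ballI allI)
  show "ext_GRS n k a v \<subseteq> carrier_vec n" by (auto simp: ext_GRS_def)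
  have "0\<^sub>v n = vec n (\<lambda>j. v j * eval_proj k 0 (a j))"
    using eval_proj_smult[of k 0 0] by (intro eq_vecI) auto
  then show "0\<^sub>v n \<in> ext_GRS n k a v" unfolding ext_GRS_def by (intro image_eqI) auto
next
  fix x y assume "x \<in> ext_GRS n k a v" "y \<in> ext_GRS n k a v"
  then obtain f g where fg: "degree f \<le> k - 1" "degree g \<le> k - 1"
    "x = vec n (\<lambda>j. v j * eval_proj k f (a j))" "y = vec n (\<lambda>j. v j * eval_proj k g (a j))"
    unfolding ext_GRS_def by blast
  have "x + y = vec n (\<lambda>j. v j * eval_proj k (f + g) (a j))"
    unfolding fg by (intro eq_vecI) (auto simp: eval_proj_add algebra_simps)
  then show "x + y \<in> ext_GRS n k a v"
    unfolding ext_GRS_def by (rule image_eqI) (use fg in \<open>auto intro: degree_add_le\<close>)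
next
  fix c x assume "x \<in> ext_GRS n k a v"
  then obtain f where f: "degree f \<le> k - 1" "x = vec n (\<lambda>j. v j * eval_proj k f (a j))"
    unfolding ext_GRS_def by blast
  have "c \<cdot>\<^sub>v x = vec n (\<lambda>j. v j * eval_proj k (Polynomial.smult c f) (a j))"
    unfolding f by (intro eq_vecI) (auto simp: eval_proj_smult)
  then show "c \<cdot>\<^sub>v x \<in> ext_GRS n k a v"
    unfolding ext_GRS_def
    by (rule image_eqI) (use f in \<open>auto intro: order.trans[OF degree_smult_le]\<close>)
qed

text \<open>A zero at infinity lowers the degree below \<open>k - 1\<close>, so it costs at least
  one of the possible affine roots.\<close>

lemma card_eval_proj_zeros:
  fixes f :: "'a::{field,finite} poly"
  assumes f: "f \<noteq> 0" "degree f \<le> k - 1"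
  shows "card {p. eval_proj k f p = 0} \<le> k - 1"
proof -
  let ?Z = "{b. poly f b = 0}"
  have Z: "{p. eval_proj k f p = 0} = Some ` ?Z \<union> (if coeff f (k - 1) = 0 then {None} else {})"
  proof (rule Set.set_eqI)
    fix p show "p \<in> {p. eval_proj k f p = 0} \<longleftrightarrow>
        p \<in> Some ` ?Z \<union> (if coeff f (k - 1) = 0 then {None} else {})"
      by (cases p) auto
  qed
  have "card {p. eval_proj k f p = 0} \<le>
      card (Some ` ?Z) + card (if coeff f (k - 1) = 0 then {None :: 'a option} else {})"
    unfolding Z by (rule card_Un_le)
  also have "\<dots> \<le> degree f + (if coeff f (k - 1) = 0 then 1 else 0)"
    using card_poly_roots_bound[OF f(1)] by (simp add: card_image)
  also have "\<dots> \<le> k - 1"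
  proof (cases "coeff f (k - 1) = 0")
    case True
    then have "degree f \<noteq> k - 1" using f(1) leading_coeff_neq_0 by metis
    then show ?thesis using f(2) by simp
  qed (use f in simp)
  finally show ?thesis .
qed

text \<open>Polynomials correspond to coefficient lists padded with zeros to length
  \<open>k\<close>. For \<open>k = 0\<close> the truncated bound would still admit the
  constants.\<close>

lemma card_polys_degree_less:
  assumes "k \<ge> 1"
  shows "card {f :: 'a::{field,finite} poly. degree f \<le> k - 1} = CARD('a) ^ k"
proof -
  have "bij_betw Poly {xs :: 'a list. set xs \<subseteq> UNIV \<and> length xs = k} {f. degree f \<le> k - 1}"
  proof (rule bij_betw_byWitness[of _ "\<lambda>f. map (coeff f) [0..<k]"])
    show "\<forall>xs\<in>{xs :: 'a list. set xs \<subseteq> UNIV \<and> length xs = k}. map (coeff (Poly xs)) [0..<k] = xs"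
      by (auto intro!: nth_equalityI simp: coeff_Poly_eq nth_default_def)
    show "\<forall>f\<in>{f :: 'a poly. degree f \<le> k - 1}. Poly (map (coeff f) [0..<k]) = f"
      using assms by (auto intro!: poly_eqI simp: coeff_Poly_eq nth_default_def coeff_eq_0)
    show "Poly ` {xs :: 'a list. set xs \<subseteq> UNIV \<and> length xs = k} \<subseteq> {f. degree f \<le> k - 1}"
      using assms by (auto intro!: degree_le simp: coeff_Poly_eq nth_default_def)
  qed auto
  then have "card {f :: 'a poly. degree f \<le> k - 1} =
      card {xs :: 'a list. set xs \<subseteq> UNIV \<and> length xs = k}"
    by (simp add: bij_betw_same_card)
  then show ?thesis using card_lists_length_eq[of "UNIV :: 'a set" k] by simp
qed

text \<open>The bound on projective zeros gives the lower bound on the distance. Equality is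
  attained by a polynomial vanishing at the first \<open>k - 1\<close> points, which
  \<open>affine\<close> keeps away from infinity.\<close>

lemma MDS_code_ext_GRS:
  fixes a :: "nat \<Rightarrow> 'a::{field,finite} option"
  assumes a: "inj_on a {..<n}" and v: "\<forall>j<n. v j \<noteq> 0" and k: "1 \<le> k" "k \<le> n"
    and affine: "\<forall>j<k - 1. a j \<noteq> None"
  shows "MDS_code n k (ext_GRS n k a v)"
proof -
  define P where "P = {f :: 'a poly. degree f \<le> k - 1}"
  define cw where "cw = (\<lambda>f. vec n (\<lambda>j. v j * eval_proj k f (a j)))"
  have code: "ext_GRS n k a v = cw ` P"
    by (simp add: ext_GRS_def cw_def P_def)
  have P_diff: "f - g \<in> P" if "f \<in> P" "g \<in> P" for f g
    using that by (auto simp: P_def intro: degree_diff_le)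
  have hd: "hamming_dist n (cw f) (cw g) = n - card {j. j < n \<and> eval_proj k (f - g) (a j) = 0}"
    for f g
  proof -
    have "{j. j < n \<and> cw f $ j \<noteq> cw g $ j} =
        {..<n} - {j. j < n \<and> eval_proj k (f - g) (a j) = 0}"
      using v by (auto simp: cw_def eval_proj_diff)
    then show ?thesis
      unfolding hamming_dist_def by (simp add: card_Diff_subset subset_eq)
  qed
  have zeros: "card {j. j < n \<and> eval_proj k f (a j) = 0} \<le> k - 1" if "f \<in> P" "f \<noteq> 0" for f
  proof -
    have "card {j. j < n \<and> eval_proj k f (a j) = 0} \<le> card {p. eval_proj k f p = 0}"
      using a by (intro card_inj_on_le[of a]) (auto simp: inj_on_def)
    also have "\<dots> \<le> k - 1" using card_eval_proj_zeros that unfolding P_def by blast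
    finally show ?thesis .
  qed
  have dist_ge: "n - k + 1 \<le> hamming_dist n (cw f) (cw g)" if "f \<in> P" "g \<in> P" "f \<noteq> g" for f g
    using zeros[OF P_diff[OF that(1,2)]] that(3) k unfolding hd by simp
  \<comment> \<open>Distinct polynomials have codewords at positive distance, so the code has as
    many words as there are polynomials.\<close>
  have inj: "inj_on cw P"
  proof (rule inj_onI, rule ccontr)
    fix f g assume fg: "f \<in> P" "g \<in> P" "cw f = cw g" "f \<noteq> g"
    have "hamming_dist n (cw f) (cw g) = 0" using fg(3) by (simp add: hamming_dist_def)
    then show False using dist_ge[OF fg(1,2,4)] by simp
  qed
  have lin: "linear_code n (cw ` P)" using linear_code_ext_GRS code by metis
  have "card (cw ` P) = CARD('a) ^ k"
    using card_image[OF inj] card_polys_degree_less[OF k(1)] P_def by simp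
  then have dim: "code_dim n (cw ` P) = k"
    using card_linear_code[OF lin] CARD_power_inject(1) by metis
  \<comment> \<open>This monic polynomial of degree \<open>k - 1\<close> uses up all its zeros on
    evaluation points; its codeword has minimum weight.\<close>
  define g where "g = (\<Prod>j<k - 1. [:- the (a j), 1:])"
  have deg_g: "degree g = k - 1"
    unfolding g_def by (subst degree_prod_eq_sum_degree) auto
  have monic_g: "lead_coeff g = 1" unfolding g_def by (simp add: lead_coeff_prod)
  then have "g \<noteq> 0" by auto
  have gP: "g \<in> P" "0 \<in> P" using deg_g by (auto simp: P_def)
  have "{..<k - 1} \<subseteq> {j. j < n \<and> eval_proj k (g - 0) (a j) = 0}"
  proof
    fix j assume j: "j \<in> {..<k - 1}"
    then obtain b where b: "a j = Some b" using affine by auto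
    then have "poly g b = 0"
      unfolding g_def poly_prod using j by (intro prod_zero) (auto intro!: bexI[of _ j])
    then show "j \<in> {j. j < n \<and> eval_proj k (g - 0) (a j) = 0}" using b j k by simp
  qed
  then have "card {..<k - 1} \<le> card {j. j < n \<and> eval_proj k (g - 0) (a j) = 0}"
    by (intro card_mono) auto
  then have "hamming_dist n (cw g) (cw 0) \<le> n - k + 1"
    unfolding hd using k by simp
  then have g_dist: "hamming_dist n (cw g) (cw 0) = n - k + 1"
    using dist_ge[OF gP \<open>g \<noteq> 0\<close>] by simp
  have "min_dist n (cw ` P) = n - k + 1"
    unfolding min_dist_def
  proof (rule Min_eqI)
    have "{hamming_dist n x y | x y. x \<in> cw ` P \<and> y \<in> cw ` P \<and> x \<noteq> y} \<subseteq>
        (\<lambda>(x, y). hamming_dist n x y) ` (cw ` P \<times> cw ` P)" by auto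
    then show "finite {hamming_dist n x y | x y. x \<in> cw ` P \<and> y \<in> cw ` P \<and> x \<noteq> y}"
      using linear_code_finite[OF lin] by (elim finite_subset) simp
  next
    fix d assume "d \<in> {hamming_dist n x y | x y. x \<in> cw ` P \<and> y \<in> cw ` P \<and> x \<noteq> y}"
    then show "n - k + 1 \<le> d" using dist_ge by auto
  next
    have "cw g \<noteq> cw 0" using inj gP \<open>g \<noteq> 0\<close> by (meson inj_onD)
    then show "n - k + 1 \<in> {hamming_dist n x y | x y. x \<in> cw ` P \<and> y \<in> cw ` P \<and> x \<noteq> y}"
      using g_dist gP by (metis (mono_tags, lifting) image_eqI mem_Collect_eq)
  qed
  then show ?thesis unfolding MDS_code_def code using lin dim by simp
qed

section \<open>Adjoining new evaluation points\<close>

lemma inj_on_lessThan_extend: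
  fixes c :: "nat \<Rightarrow> 'b::finite"
  assumes c: "inj_on c {..<n}" and le: "n + i \<le> CARD('b)"
  shows "\<exists>b. inj_on b {..<n + i} \<and> (\<forall>j<n. b j = c j)"
proof -
  \<comment> \<open>The values not taken by \<open>c\<close> number \<open>CARD('b) - n\<close>,
    enough for \<open>i\<close> new ones.\<close>
  have "card {n..<n + i} \<le> card (UNIV - c ` {..<n})"
    using le by (simp add: card_Diff_subset card_image[OF c])
  then obtain g where g: "g ` {n..<n + i} \<subseteq> UNIV - c ` {..<n}" "inj_on g {n..<n + i}"
    using card_le_inj[of "{n..<n + i}" "UNIV - c ` {..<n}"] by auto
  define b where "b = (\<lambda>j. if j < n then c j else g j)"
  have "{..<n + i} = {..<n} \<union> {n..<n + i}" by auto
  moreover have "inj_on b ({..<n} \<union> {n..<n + i})"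
    using c g unfolding inj_on_Un by (auto simp: b_def inj_on_def)
  ultimately show ?thesis by (intro exI[of _ b]) (simp add: b_def)
qed

theorem corollary2:
  fixes q n k l :: nat
  assumes "primepow q" and "q > 2"
    and "CARD('a::{field,finite}) = q\<^sup>2"
    and "l \<le> k"
    and "\<exists>C :: 'a vec set. GRS_code n k C \<and> code_dim n (hermitian_hull q n C) = l"
  shows "\<forall>i s. 1 \<le> i \<and> i \<le> min l (q\<^sup>2 + 1 - n) \<and> s \<le> l - i \<longrightarrow>
    (\<exists>D :: 'a vec set. MDS_code (n + i) k D \<and>
       code_dim (n + i) (hermitian_hull q (n + i) D) = s)"
proof (intro allI impI)
  fix i s assume i_s: "1 \<le> i \<and> i \<le> min l (q\<^sup>2 + 1 - n) \<and> s \<le> l - i"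
  interpret hermitian_field q "TYPE('a)"
    by unfold_locales (use assms in auto)
  obtain C :: "'a vec set" where "GRS_code n k C" and l: "code_dim n (hermitian_hull q n C) = l"
    using assms(5) by blast
  then obtain a v :: "nat \<Rightarrow> 'a" where k: "1 \<le> k" "k \<le> n" and a: "inj_on a {..<n}"
    and v: "\<forall>j<n. v j \<noteq> 0" and C: "C = {vec n (\<lambda>j. v j * poly f (a j)) | f. degree f \<le> k - 1}"
    unfolding GRS_code_def by blast
  have "inj_on (\<lambda>j. Some (a j)) {..<n}" using a by (auto simp: inj_on_def)
  \<comment> \<open>The projective line has q^2 + 1 points. Since \<open>1 \<le> i\<close>, the
    subtraction in the bound on \<open>i\<close> is not truncated.\<close>
  moreover have "n + i \<le> CARD('a option)" using i_s by (auto simp: assms(3) card_UNIV_option)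
  ultimately obtain b where b: "inj_on b {..<n + i}" "\<forall>j<n. b j = Some (a j)"
    using inj_on_lessThan_extend by blast
  \<comment> \<open>The new multipliers may be any nonzero values; they are adjusted by the final
    rescaling.\<close>
  define w where "w = (\<lambda>j. if j < n then v j else 1)"
  define D where "D = ext_GRS (n + i) k b w"
  have linD: "linear_code (n + i) D" unfolding D_def by (rule linear_code_ext_GRS)
  have MDS: "MDS_code (n + i) k D"
    unfolding D_def using b k v by (intro MDS_code_ext_GRS) (auto simp: w_def)
  \<comment> \<open>Deleting the new coordinates gives back \<open>C\<close>, so the hull of
    \<open>D\<close> has dimension at least \<open>l - i\<close>.\<close>
  have "(\<lambda>x. vec n (($) x)) ` D = (\<lambda>f. vec n (\<lambda>j. v j * poly f (a j))) ` {f. degree f \<le> k - 1}"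
    unfolding D_def ext_GRS_def image_image
    by (intro image_cong refl eq_vecI) (auto simp: w_def b)
  also have "\<dots> = C" unfolding C by blast
  finally have CD: "(\<lambda>x. vec n (($) x)) ` D = C" .
  have "C = ext_GRS n k (\<lambda>j. Some (a j)) v" unfolding C ext_GRS_def by auto
  then have "linear_code n C" by (simp add: linear_code_ext_GRS)
  then have "l \<le> code_dim (n + i) (hermitian_hull q (n + i) D) + i"
    using hull_dim_punctured_le[OF linD] l unfolding CD by simp
  then have "s \<le> code_dim (n + i) (hermitian_hull q (n + i) D)" using i_s by linarith
  \<comment> \<open>Rescaling lowers the hull dimension to exactly \<open>s\<close> and preserves
    the MDS property.\<close>
  then obtain u where u: "\<forall>j<n + i. u j \<noteq> 0"
    "code_dim (n + i) (hermitian_hull q (n + i) (scale_vec (n + i) u ` D)) = s"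
    using hull_dim_reduce[OF linD assms(2)] by blast
  then show "\<exists>D :: 'a vec set. MDS_code (n + i) k D \<and>
      code_dim (n + i) (hermitian_hull q (n + i) D) = s"
    using MDS_code_scale[OF MDS u(1)] by blast
qed

end
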